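(* Let $\tau>0$ be the time step, $s\ge1$, and let $(a_{ij},b_i,c_i)_{i,j=1}^s$ be the coefficients of the $s$-stage Gauss collocation Runge–Kutta method. Let $\Lambda\ge1$ be the maximal number of iterations. Consider the method ESAV-Gauss-PC: given $z^n\in V$, $e^n>0$ and the extrapolated values $z_{s,i}^n\in V$, $e_{s,i}^n\in\mathbb{R}$ (described in the context), set $z_i^{n(1)}=z_{s,i}^n$, $e_i^{n(1)}=e_{s,i}^n$ and, for $\lambda=1,2,\dots,\Lambda$ and $i=1,\dots,s$, solve $$z_i^{n(\lambda+1)}=z^n+\tau\sum_{j=1}^sa_{ij}k_j^{n(\lambda+1)},\quad k_i^{n(\lambda+1)}=\mathcal{D}\mu_i^{n(\lambda+1)},\quad \mu_i^{n(\lambda+1)}=\mathcal{L}z_i^{n(\lambda+1)}+B\big(z_i^{n(\lambda)},e_i^{n(\lambda)}\big),$$ $$e_i^{n(\lambda+1)}=\exp\Big(\ln(e^n)+\tau\sum_{j=1}^sa_{ij}l_j^{n(\lambda+1)}\Big),\quad l_i^{n(\lambda+1)}=\Big(B\big(z_i^{n(\lambda)},e_i^{n(\lambda)}\big),k_i^{n(\lambda+1)}\Big),$$ where $B(z,e)=\mathcal{N}'(z)\,e/\exp(\mathcal{H}_2(z))$; after the iteration is terminated at some step $\lambda\in\{1,\dots,\Lambda\}$, update $$z^{n+1}=z^n+\tau\sum_{i=1}^sb_ik_i^{n(\lambda+1)},\qquad e^{n+1}=\exp\Big(\ln(e^n)+\tau\sum_{i=1}^sb_il_i^{n(\lambda+1)}\Big).$$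 Then for each iteration step $\lambda=1,2,\dots,\Lambda$ (i.e. whichever $\lambda$ is used in the update), ESAV-Gauss-PC is a linear energy-preserving method, with the discrete energy conservation law $$\tilde{\mathcal{H}}_s^{n+1}=\tilde{\mathcal{H}}_s^n,\qquad \tilde{\mathcal{H}}_s^n=\frac12\big(z^n,\mathcal{L}z^n\big)+\ln(e^n).$$
   Context: Setting. $\Omega\subset\mathbb{R}^d$ is a spatial region with periodic boundary conditions, $(\cdot,\cdot)$ is the real $L^2$ inner product on $\Omega$, and $V$ is the space of sufficiently smooth real-valued (possibly vector-valued) periodic functions on $\Omega$. $\mathcal{D}:V\to V$ is a linear skew-adjoint operator, $(\mathcal{D}f,g)=-(f,\mathcal{D}g)$, independent of the solution $z$ and its derivatives. $\mathcal{L}:V\to V$ is a linear, symmetric, non-negative operator: $(\mathcal{L}f,g)=(f,\mathcal{L}g)$ and $(f,\mathcal{L}f)\ge 0$. The Hamiltonian PDE is $$z_t=\mathcal{D}\mu,\qquad \mu=\mathcal{L}z+\mathcal{N}'(z),\qquad \mathcal{H}(z)=\tfrac12(z,\mathcal{L}z)+\mathcal{H}_2(z),\qquad \mathcal{H}_2(z)=(\mathcal{N}(z),1),$$ where $\mathcal{N}(z)$ is a (smooth) energy density and $\mathcal{N}'(z)=\delta\mathcal{H}_2/\delta z$ is the variational derivative of $\mathcal{H}_2$. With the scalar auxiliary variable $e(t)=\exp(\mathcal{H}_2(z(\cdot,t)))>0$ the PDE is rewritten equivalently as $$z_t=\mathcal{D}\mu,\qquad \mu=\mathcal{L}z+B(z,e),\qquad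 \frac{d}{dt}\ln(e)=\big(B(z,e),z_t\big),$$ and the method in the claim is a time discretization of this system with $t_n=t_0+n\tau$. Gauss coefficients: $c_1,\dots,c_s$ are the zeros of the $s$-th shifted Legendre polynomial on $[0,1]$, $b_i=\int_0^1\ell_i(x)\,dx$ are the Gauss quadrature weights, and $a_{ij}=\int_0^{c_i}\ell_j(x)\,dx$, where $\ell_j$ are the Lagrange basis polynomials for the nodes $c_1,\dots,c_s$. It is a known fact that these satisfy the symplecticity condition $b_ia_{ij}+b_ja_{ji}=b_ib_j$ for all $i,j$. Extrapolated values (prediction): for $n\ge1$, $z_{s,i}^n$ is the value at time $t_n+c_i\tau$ of the polynomial in time of degree at most $s$ interpolating $z^{n-1}$ at $t_{n-1}$ and the internal stage values $z_j^{n-1}$ of the previous step at $t_{n-1}+c_j\tau$, $j=1,\dots,s$; $e_{s,i}^n$ is obtained in the same way from $e^{n-1}$ and $e_j^{n-1}$. Stopping rule: given a tolerance $TOL>0$, the iteration stops at the first $\lambda\le\Lambda$ for which $\max_{1\le i\le s}\{\|z_i^{n(\lambda+1)}-z_i^{n(\lambda)}\|_\infty,\ |e_i^{n(\lambda+1)}-e_i^{n(\lambda)}|\}<TOL$, and at $\lambda=\Lambda$ if this never happens. Terminology. "Linear" means that in each iteration step the only equations to be solved are linear equations for the stages $z_1^{n(\lambda+1)},\dots,z_s^{n(\lambda+1)}$ with coefficient operators independent of the solution, the remaining quantities then being given explicitly. "Energy-preserving" means that the stated discrete energy conservation law holds for every solution of the scheme. *)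

theory Defs
  imports
    "HOL-Analysis.Analysis"
    "HOL-Computational_Algebra.Polynomial"
    "HOL-Library.Extended_Nat"
begin

section \<open>Periodic functions on a box\<close>

primrec C_k :: "nat \<Rightarrow> ('d::euclidean_space \<Rightarrow> 'v::real_normed_vector) \<Rightarrow> bool" where
  "C_k 0 f \<longleftrightarrow> continuous_on UNIV f"
| "C_k (Suc k) f \<longleftrightarrow>
     (\<forall>x. f differentiable (at x)) \<and> (\<forall>v. C_k k (\<lambda>x. frechet_derivative f (at x) v))"

text \<open>The domain is the period cell \<open>cbox p q\<close>; a function satisfying the periodic boundary
  conditions is represented by its periodic extension to the whole space. The regularity
  \<open>r\<close> may be any natural number or \<open>\<infinity>\<close>.\<close>

definition periodic_space ::
    "'d::euclidean_space \<Rightarrow> 'd \<Rightarrow> enat \<Rightarrow> ('d \<Rightarrow> 'v::real_normed_vector) set" where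
  "periodic_space p q r =
     {f. (\<forall>k. enat k \<le> r \<longrightarrow> C_k k f) \<and>
         (\<forall>x. \<forall>i\<in>Basis. f (x + ((q - p) \<bullet> i) *\<^sub>R i) = f x)}"

definition L2_inner ::
    "'d::euclidean_space \<Rightarrow> 'd \<Rightarrow> ('d \<Rightarrow> 'v::euclidean_space) \<Rightarrow> ('d \<Rightarrow> 'v) \<Rightarrow> real" where
  "L2_inner p q f g = (LINT x:cbox p q|lborel. f x \<bullet> g x)"

definition linear_operator_on ::
    "('d \<Rightarrow> 'v::real_vector) set \<Rightarrow> (('d \<Rightarrow> 'v) \<Rightarrow> ('d \<Rightarrow> 'v)) \<Rightarrow> bool" where
  "linear_operator_on V T \<longleftrightarrow>
     (\<forall>f\<in>V. T f \<in> V) \<and>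
     (\<forall>f\<in>V. \<forall>g\<in>V. T (\<lambda>x. f x + g x) = (\<lambda>x. T f x + T g x)) \<and>
     (\<forall>\<alpha>. \<forall>f\<in>V. T (\<lambda>x. \<alpha> *\<^sub>R f x) = (\<lambda>x. \<alpha> *\<^sub>R T f x))"


section \<open>The Hamiltonian PDE\<close>

text \<open>\<open>density\<close> is an operator on functions, so that the energy density may depend on
  the derivatives of \<open>z\<close>.\<close>

record ('d, 'v) ham_pde =
  lower :: 'd
  upper :: 'd
  regularity :: enat
  skew_op :: "('d \<Rightarrow> 'v) \<Rightarrow> ('d \<Rightarrow> 'v)"
  sym_op :: "('d \<Rightarrow> 'v) \<Rightarrow> ('d \<Rightarrow> 'v)"
  density :: "('d \<Rightarrow> 'v) \<Rightarrow> ('d \<Rightarrow> real)"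
  var_deriv :: "('d \<Rightarrow> 'v) \<Rightarrow> ('d \<Rightarrow> 'v)"

definition space_V :: "('d::euclidean_space, 'v::euclidean_space) ham_pde \<Rightarrow> ('d \<Rightarrow> 'v) set" where
  "space_V P = periodic_space (lower P) (upper P) (regularity P)"

definition ip ::
    "('d::euclidean_space, 'v::euclidean_space) ham_pde \<Rightarrow> ('d \<Rightarrow> 'v) \<Rightarrow> ('d \<Rightarrow> 'v) \<Rightarrow> real" where
  "ip P f g = L2_inner (lower P) (upper P) f g"

definition H2 :: "('d::euclidean_space, 'v::euclidean_space) ham_pde \<Rightarrow> ('d \<Rightarrow> 'v) \<Rightarrow> real" where
  "H2 P z = L2_inner (lower P) (upper P) (density P z) (\<lambda>_. 1)"

definition is_variational_derivative ::
    "('d::euclidean_space, 'v::euclidean_space) ham_pde \<Rightarrow>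
     (('d \<Rightarrow> 'v) \<Rightarrow> real) \<Rightarrow> (('d \<Rightarrow> 'v) \<Rightarrow> ('d \<Rightarrow> 'v)) \<Rightarrow> bool" where
  "is_variational_derivative P F G \<longleftrightarrow>
     (\<forall>z\<in>space_V P. G z \<in> space_V P \<and>
        (\<forall>v\<in>space_V P.
           ((\<lambda>\<epsilon>. F (\<lambda>x. z x + \<epsilon> *\<^sub>R v x)) has_real_derivative ip P (G z) v) (at 0)))"

text \<open>The density only has to be continuous in space: for finite \<open>regularity\<close> it loses
  derivatives relative to \<open>z\<close> when it involves derivatives of \<open>z\<close>.\<close>

definition hamiltonian_pde :: "('d::euclidean_space, 'v::euclidean_space) ham_pde \<Rightarrow> bool" where
  "hamiltonian_pde P \<longleftrightarrow>
     (\<forall>i\<in>Basis. lower P \<bullet> i < upper P \<bullet> i) \<and>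
     linear_operator_on (space_V P) (skew_op P) \<and>
     (\<forall>f\<in>space_V P. \<forall>g\<in>space_V P. ip P (skew_op P f) g = - ip P f (skew_op P g)) \<and>
     linear_operator_on (space_V P) (sym_op P) \<and>
     (\<forall>f\<in>space_V P. \<forall>g\<in>space_V P. ip P (sym_op P f) g = ip P f (sym_op P g)) \<and>
     (\<forall>f\<in>space_V P. ip P f (sym_op P f) \<ge> 0) \<and>
     (\<forall>z\<in>space_V P. density P z \<in> periodic_space (lower P) (upper P) 0) \<and>
     is_variational_derivative P (H2 P) (var_deriv P)"

definition B ::
    "('d::euclidean_space, 'v::euclidean_space) ham_pde \<Rightarrow> ('d \<Rightarrow> 'v) \<Rightarrow> real \<Rightarrow> ('d \<Rightarrow> 'v)" where
  "B P z e = (\<lambda>x. (e / exp (H2 P z)) *\<^sub>R var_deriv P z x)"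


section \<open>Gauss collocation coefficients\<close>

text \<open>Rodrigues' formula on \<open>[0,1]\<close>.\<close>

definition shifted_legendre :: "nat \<Rightarrow> real poly" where
  "shifted_legendre s = smult (1 / fact s) ((pderiv ^^ s) ([:0, -1, 1:] ^ s))"

definition lagrange_basis :: "nat \<Rightarrow> (nat \<Rightarrow> real) \<Rightarrow> nat \<Rightarrow> real \<Rightarrow> real" where
  "lagrange_basis s c j x = (\<Prod>m\<in>{1..s} - {j}. (x - c m) / (c j - c m))"

definition gauss_coefficients ::
    "nat \<Rightarrow> (nat \<Rightarrow> nat \<Rightarrow> real) \<Rightarrow> (nat \<Rightarrow> real) \<Rightarrow> (nat \<Rightarrow> real) \<Rightarrow> bool" where
  "gauss_coefficients s a b c \<longleftrightarrow>
     bij_betw c {1..s} {x. poly (shifted_legendre s) x = 0} \<and>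
     (\<forall>i\<in>{1..s}. b i = (LBINT x=0..1. lagrange_basis s c i x)) \<and>
     (\<forall>i\<in>{1..s}. \<forall>j\<in>{1..s}. a i j = (LBINT x=0..c i. lagrange_basis s c j x))"


section \<open>The ESAV-Gauss-PC method\<close>

record ('d, 'v) stages =
  stg_z :: "nat \<Rightarrow> 'd \<Rightarrow> 'v"
  stg_k :: "nat \<Rightarrow> 'd \<Rightarrow> 'v"
  stg_mu :: "nat \<Rightarrow> 'd \<Rightarrow> 'v"
  stg_e :: "nat \<Rightarrow> real"
  stg_l :: "nat \<Rightarrow> real"

text \<open>\<open>Y\<close> solves one iteration step at \<open>(zn, en)\<close>, where \<open>Z\<close> and \<open>E\<close> are the previous iterates
  of the stages of \<open>z\<close> and \<open>e\<close>.\<close>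

definition iteration_step ::
    "('d::euclidean_space, 'v::euclidean_space) ham_pde \<Rightarrow> nat \<Rightarrow> (nat \<Rightarrow> nat \<Rightarrow> real) \<Rightarrow> real \<Rightarrow>
     ('d \<Rightarrow> 'v) \<Rightarrow> real \<Rightarrow> (nat \<Rightarrow> 'd \<Rightarrow> 'v) \<Rightarrow> (nat \<Rightarrow> real) \<Rightarrow> ('d, 'v) stages \<Rightarrow> bool" where
  "iteration_step P s a \<tau> zn en Z E Y \<longleftrightarrow>
     (\<forall>i\<in>{1..s}.
        stg_z Y i \<in> space_V P \<and>
        stg_z Y i = (\<lambda>x. zn x + \<tau> *\<^sub>R (\<Sum>j=1..s. a i j *\<^sub>R stg_k Y j x)) \<and>
        stg_k Y i = skew_op P (stg_mu Y i) \<and>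
        stg_mu Y i = (\<lambda>x. sym_op P (stg_z Y i) x + B P (Z i) (E i) x) \<and>
        stg_e Y i = exp (ln en + \<tau> * (\<Sum>j=1..s. a i j * stg_l Y j)) \<and>
        stg_l Y i = ip P (B P (Z i) (E i)) (stg_k Y i))"

text \<open>One time step whose iteration is terminated at step \<open>lam\<close>. \<open>Y \<nu>\<close> holds the \<open>\<nu>\<close>-th
  iterates; only the \<open>stg_z\<close> and \<open>stg_e\<close> components of \<open>Y 1\<close>, the predicted values,
  are relevant.\<close>

definition time_step ::
    "('d::euclidean_space, 'v::euclidean_space) ham_pde \<Rightarrow> nat \<Rightarrow>
     (nat \<Rightarrow> nat \<Rightarrow> real) \<Rightarrow> (nat \<Rightarrow> real) \<Rightarrow> real \<Rightarrow> nat \<Rightarrow>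
     ('d \<Rightarrow> 'v) \<Rightarrow> real \<Rightarrow> (nat \<Rightarrow> 'd \<Rightarrow> 'v) \<Rightarrow> (nat \<Rightarrow> real) \<Rightarrow>
     nat \<Rightarrow> (nat \<Rightarrow> ('d, 'v) stages) \<Rightarrow> ('d \<Rightarrow> 'v) \<Rightarrow> real \<Rightarrow> bool" where
  "time_step P s a b \<tau> \<Lambda> zn en zs es lam Y zn1 en1 \<longleftrightarrow>
     lam \<in> {1..\<Lambda>} \<and>
     (\<forall>i\<in>{1..s}. stg_z (Y 1) i = zs i \<and> stg_e (Y 1) i = es i) \<and>
     (\<forall>\<nu>\<in>{1..lam}. iteration_step P s a \<tau> zn en (stg_z (Y \<nu>)) (stg_e (Y \<nu>)) (Y (\<nu> + 1))) \<and>
     zn1 = (\<lambda>x. zn x + \<tau> *\<^sub>R (\<Sum>i=1..s. b i *\<^sub>R stg_k (Y (lam + 1)) i x)) \<and>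
     en1 = exp (ln en + \<tau> * (\<Sum>i=1..s. b i * stg_l (Y (lam + 1)) i))"

text \<open>\<open>w i\<close> is the value at \<open>t + \<tau> + c\<^sub>i \<tau>\<close> of the polynomial of degree at most \<open>s\<close> with
  value \<open>y0\<close> at \<open>t\<close> and values \<open>y j\<close> at \<open>t + c\<^sub>j \<tau>\<close>.\<close>

definition extrapolated ::
    "nat \<Rightarrow> (nat \<Rightarrow> real) \<Rightarrow> real \<Rightarrow> real \<Rightarrow>
     'v::real_vector \<Rightarrow> (nat \<Rightarrow> 'v) \<Rightarrow> (nat \<Rightarrow> 'v) \<Rightarrow> bool" where
  "extrapolated s c \<tau> t y0 y w \<longleftrightarrow>
     (\<exists>p :: nat \<Rightarrow> 'v.
        (\<Sum>m\<le>s. t ^ m *\<^sub>R p m) = y0 \<and>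
        (\<forall>j\<in>{1..s}. (\<Sum>m\<le>s. (t + c j * \<tau>) ^ m *\<^sub>R p m) = y j) \<and>
        (\<forall>i\<in>{1..s}. w i = (\<Sum>m\<le>s. (t + \<tau> + c i * \<tau>) ^ m *\<^sub>R p m)))"

text \<open>\<open>M\<close> time steps of the method. \<open>lam n\<close> is the iteration step at which time step \<open>n\<close> is
  terminated; it is not tied to a particular stopping rule. The predicted values of the first
  time step, which has no predecessor to extrapolate from, are arbitrary.\<close>

definition esav_gauss_pc ::
    "('d::euclidean_space, 'v::euclidean_space) ham_pde \<Rightarrow> nat \<Rightarrow>
     (nat \<Rightarrow> nat \<Rightarrow> real) \<Rightarrow> (nat \<Rightarrow> real) \<Rightarrow> (nat \<Rightarrow> real) \<Rightarrow> real \<Rightarrow> real \<Rightarrow> nat \<Rightarrow> nat \<Rightarrow>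
     (nat \<Rightarrow> 'd \<Rightarrow> 'v) \<Rightarrow> (nat \<Rightarrow> real) \<Rightarrow> (nat \<Rightarrow> nat \<Rightarrow> 'd \<Rightarrow> 'v) \<Rightarrow> (nat \<Rightarrow> nat \<Rightarrow> real) \<Rightarrow>
     (nat \<Rightarrow> nat) \<Rightarrow> (nat \<Rightarrow> nat \<Rightarrow> ('d, 'v) stages) \<Rightarrow> bool" where
  "esav_gauss_pc P s a b c t0 \<tau> \<Lambda> M z e zs es lam Y \<longleftrightarrow>
     z 0 \<in> space_V P \<and> e 0 > 0 \<and>
     (\<forall>n<M. \<forall>i\<in>{1..s}. zs n i \<in> space_V P) \<and>
     (\<forall>n. Suc n < M \<longrightarrow>
        (\<forall>x. extrapolated s c \<tau> (t0 + real n * \<tau>) (z n x)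
               (\<lambda>j. stg_z (Y n (lam n + 1)) j x) (\<lambda>i. zs (Suc n) i x)) \<and>
        extrapolated s c \<tau> (t0 + real n * \<tau>) (e n)
          (stg_e (Y n (lam n + 1))) (es (Suc n))) \<and>
     (\<forall>n<M. time_step P s a b \<tau> \<Lambda> (z n) (e n) (zs n) (es n) (lam n) (Y n)
               (z (Suc n)) (e (Suc n)))"

definition modified_energy ::
    "('d::euclidean_space, 'v::euclidean_space) ham_pde \<Rightarrow> ('d \<Rightarrow> 'v) \<Rightarrow> real \<Rightarrow> real" where
  "modified_energy P z e = 1/2 * ip P z (sym_op P z) + ln e"


section \<open>Linearity of the iteration step\<close>

text \<open>The block \<open>\<delta>\<^sub>i\<^sub>j - \<tau> a\<^sub>i\<^sub>j D L\<close> obtained by eliminating \<open>\<mu>\<close> and \<open>k\<close> from the iteration step.\<close>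

definition coefficient_op ::
    "('d::euclidean_space, 'v::euclidean_space) ham_pde \<Rightarrow> (nat \<Rightarrow> nat \<Rightarrow> real) \<Rightarrow> real \<Rightarrow>
     nat \<Rightarrow> nat \<Rightarrow> ('d \<Rightarrow> 'v) \<Rightarrow> ('d \<Rightarrow> 'v)" where
  "coefficient_op P a \<tau> i j f =
     (\<lambda>x. (if i = j then f x else 0) - (\<tau> * a i j) *\<^sub>R skew_op P (sym_op P f) x)"

definition right_hand_side ::
    "('d::euclidean_space, 'v::euclidean_space) ham_pde \<Rightarrow> nat \<Rightarrow> (nat \<Rightarrow> nat \<Rightarrow> real) \<Rightarrow> real \<Rightarrow>
     ('d \<Rightarrow> 'v) \<Rightarrow> (nat \<Rightarrow> 'd \<Rightarrow> 'v) \<Rightarrow> (nat \<Rightarrow> real) \<Rightarrow> nat \<Rightarrow> ('d \<Rightarrow> 'v)" where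
  "right_hand_side P s a \<tau> zn Z E i =
     (\<lambda>x. zn x + \<tau> *\<^sub>R (\<Sum>j=1..s. a i j *\<^sub>R skew_op P (B P (Z j) (E j)) x))"

definition explicit_mu ::
    "('d::euclidean_space, 'v::euclidean_space) ham_pde \<Rightarrow> (nat \<Rightarrow> 'd \<Rightarrow> 'v) \<Rightarrow> (nat \<Rightarrow> real) \<Rightarrow>
     (nat \<Rightarrow> 'd \<Rightarrow> 'v) \<Rightarrow> nat \<Rightarrow> ('d \<Rightarrow> 'v)" where
  "explicit_mu P Z E y i = (\<lambda>x. sym_op P (y i) x + B P (Z i) (E i) x)"

definition explicit_k ::
    "('d::euclidean_space, 'v::euclidean_space) ham_pde \<Rightarrow> (nat \<Rightarrow> 'd \<Rightarrow> 'v) \<Rightarrow> (nat \<Rightarrow> real) \<Rightarrow>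
     (nat \<Rightarrow> 'd \<Rightarrow> 'v) \<Rightarrow> nat \<Rightarrow> ('d \<Rightarrow> 'v)" where
  "explicit_k P Z E y i = skew_op P (explicit_mu P Z E y i)"

definition explicit_l ::
    "('d::euclidean_space, 'v::euclidean_space) ham_pde \<Rightarrow> (nat \<Rightarrow> 'd \<Rightarrow> 'v) \<Rightarrow> (nat \<Rightarrow> real) \<Rightarrow>
     (nat \<Rightarrow> 'd \<Rightarrow> 'v) \<Rightarrow> nat \<Rightarrow> real" where
  "explicit_l P Z E y i = ip P (B P (Z i) (E i)) (explicit_k P Z E y i)"

definition explicit_e ::
    "('d::euclidean_space, 'v::euclidean_space) ham_pde \<Rightarrow> nat \<Rightarrow> (nat \<Rightarrow> nat \<Rightarrow> real) \<Rightarrow> real \<Rightarrow>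
     real \<Rightarrow> (nat \<Rightarrow> 'd \<Rightarrow> 'v) \<Rightarrow> (nat \<Rightarrow> real) \<Rightarrow> (nat \<Rightarrow> 'd \<Rightarrow> 'v) \<Rightarrow> nat \<Rightarrow> real" where
  "explicit_e P s a \<tau> en Z E y i =
     exp (ln en + \<tau> * (\<Sum>j=1..s. a i j * explicit_l P Z E y j))"

text \<open>The iteration step amounts to a linear system for the stages of \<open>z\<close>, with coefficient
  operators fixed before \<open>zn\<close>, \<open>en\<close>, \<open>Z\<close>, \<open>E\<close> and the unknowns are chosen, followed by
  evaluation of explicit formulas for the remaining quantities. System and formulas are written
  out, because merely asserting that a linear system exists would also be satisfied by any
  uniquely solvable nonlinear scheme (identity matrix, with the solution as right-hand side).\<close>

definition linear_iteration ::
    "('d::euclidean_space, 'v::euclidean_space) ham_pde \<Rightarrow> nat \<Rightarrow> (nat \<Rightarrow> nat \<Rightarrow> real) \<Rightarrow>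
     real \<Rightarrow> bool" where
  "linear_iteration P s a \<tau> \<longleftrightarrow>
     (\<forall>i\<in>{1..s}. \<forall>j\<in>{1..s}. linear_operator_on (space_V P) (coefficient_op P a \<tau> i j)) \<and>
     (\<forall>zn en Z E Y.
        zn \<in> space_V P \<longrightarrow> en > 0 \<longrightarrow> (\<forall>i\<in>{1..s}. Z i \<in> space_V P) \<longrightarrow>
        (iteration_step P s a \<tau> zn en Z E Y \<longleftrightarrow>
          (\<forall>i\<in>{1..s}. stg_z Y i \<in> space_V P \<and>
             (\<lambda>x. \<Sum>j=1..s. coefficient_op P a \<tau> i j (stg_z Y j) x)
               = right_hand_side P s a \<tau> zn Z E i) \<and>
          (\<forall>i\<in>{1..s}.
             stg_mu Y i = explicit_mu P Z E (stg_z Y) i \<and>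
             stg_k Y i = explicit_k P Z E (stg_z Y) i \<and>
             stg_l Y i = explicit_l P Z E (stg_z Y) i \<and>
             stg_e Y i = explicit_e P s a \<tau> en Z E (stg_z Y) i)))"

end

theory Submission
  imports Defs
begin

text \<open>
  The nonlinearity \<open>B\<close> is evaluated at the previous iterates, so inside one iteration
  step it is a known element of the function space. Substituting \<open>\<mu>\<close> into \<open>k\<close> and using linearity of
  the two operators turns the stage equations into a linear system whose blocks are
  \<open>\<delta>\<^sub>i\<^sub>j - \<tau> a\<^sub>i\<^sub>j D L\<close> (lemma \<open>iteration_is_linear\<close>).

  For the energy, Gauss coefficients are symplectic,
  \<open>b\<^sub>i a\<^sub>i\<^sub>j + b\<^sub>j a\<^sub>j\<^sub>i = b\<^sub>i b\<^sub>j\<close>, and for symplectic coefficients a quadratic functional obeys the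
  product rule exactly: the increment of \<open>(z, L z) / 2\<close> over one step is
  \<open>\<tau> \<Sum> b\<^sub>i (k\<^sub>i, L z\<^sub>i)\<close> (lemma \<open>quadratic_energy_increment\<close>). The increment of
  \<open>ln e\<close> is \<open>\<tau> \<Sum> b\<^sub>i (B\<^sub>i, k\<^sub>i)\<close> by construction of the update. The sum of the two is
  \<open>\<tau> \<Sum> b\<^sub>i (k\<^sub>i, \<mu>\<^sub>i)\<close>, in which every term vanishes because \<open>k\<^sub>i = D \<mu>\<^sub>i\<close> and \<open>D\<close> is skew.
  The values \<open>B\<^sub>i\<close> may be taken at any elements of the function space, as long as both
  updates use the same ones; hence every iteration index conserves the energy.

  For symplecticity (lemma \<open>gauss_symplectic\<close>), let \<open>A\<^sub>j(x)\<close> be the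
  integral of \<open>\<ell>\<^sub>j\<close> from \<open>0\<close> to \<open>x\<close>. The product \<open>A\<^sub>i A\<^sub>j\<close> has derivative \<open>\<ell>\<^sub>i A\<^sub>j + A\<^sub>i \<ell>\<^sub>j\<close>, a polynomial of degree below \<open>2 s\<close>. Its integral over
  \<open>[0,1]\<close> is \<open>b\<^sub>i b\<^sub>j\<close>, while Gauss quadrature, exact in this degree, evaluates it to
  \<open>b\<^sub>i a\<^sub>i\<^sub>j + b\<^sub>j a\<^sub>j\<^sub>i\<close>. Exactness rests on the orthogonality of the Legendre polynomial to all
  polynomials of lower degree, that is, on repeated integration by parts in Rodrigues' formula.
\<close>

section \<open>Integrals of polynomials\<close>

text \<open>The integral is a function of the polynomial rather than of its evaluation map, so that
  arithmetic on polynomials is not pushed into the integrand.\<close>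

definition poly_integral :: "real \<Rightarrow> real poly \<Rightarrow> real" where
  "poly_integral t p = (LBINT x=0..ereal t. poly p x)"

lemma poly_integral_pderiv: "poly_integral t (pderiv G) = poly G t - poly G 0"
proof -
  have "(LBINT x=ereal 0..ereal t. poly (pderiv G) x) = poly G t - poly G 0"
    by (rule interval_integral_FTC_finite)
      (auto intro!: continuous_intros poly_DERIV[THEN DERIV_subset]
        simp flip: has_real_derivative_iff_has_vector_derivative)
  then show ?thesis
    by (simp add: poly_integral_def zero_ereal_def)
qed

lemma antiderivative_exists:
  fixes p :: "real poly"
  shows "\<exists>G. pderiv G = p \<and> poly G 0 = 0 \<and> degree G \<le> degree p + 1"
proof (intro exI conjI)
  let ?G = "\<Sum>i\<le>degree p. monom (coeff p i / (real i + 1)) (i + 1)"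
  have "pderiv ?G = (\<Sum>i\<le>degree p. monom (coeff p i) i)"
    unfolding higher_pderiv_sum[of 1, simplified]
    by (intro sum.cong refl) (simp add: pderiv_monom field_simps)
  then show "pderiv ?G = p"
    by (simp add: poly_as_sum_of_monoms)
  show "poly ?G 0 = 0"
    by (simp add: poly_sum poly_monom)
  show "degree ?G \<le> degree p + 1"
    by (rule degree_sum_le) (auto intro: order_trans[OF degree_monom_le])
qed

lemma poly_integral_add:
  fixes p q :: "real poly"
  shows "poly_integral t (p + q) = poly_integral t p + poly_integral t q"
proof -
  obtain G H where "p = pderiv G" "q = pderiv H"
    using antiderivative_exists by metis
  moreover from this have "p + q = pderiv (G + H)"
    by (simp add: pderiv_add)
  ultimately show ?thesis
    by (simp only: poly_integral_pderiv) simp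
qed

lemma poly_integral_smult:
  fixes p :: "real poly"
  shows "poly_integral t (smult r p) = r * poly_integral t p"
proof -
  obtain G where "p = pderiv G"
    using antiderivative_exists by metis
  moreover from this have "smult r p = pderiv (smult r G)"
    by (simp add: pderiv_smult)
  ultimately show ?thesis
    by (simp only: poly_integral_pderiv) (simp add: algebra_simps)
qed

lemma poly_integral_sum:
  fixes p :: "'i \<Rightarrow> real poly"
  shows "poly_integral t (\<Sum>i\<in>A. p i) = (\<Sum>i\<in>A. poly_integral t (p i))"
  by (induction A rule: infinite_finite_induct)
    (simp_all add: poly_integral_add, simp_all add: poly_integral_def)

section \<open>Orthogonality of the shifted Legendre polynomials\<close>

text \<open>Each differentiation lowers the multiplicity of a factor by at most one.\<close>

lemma power_dvd_higher_pderiv: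
  fixes u p :: "real poly"
  assumes "u ^ n dvd p" and "m \<le> n"
  shows "u ^ (n - m) dvd (pderiv ^^ m) p"
  using assms(2)
proof (induction m)
  case 0
  then show ?case using assms(1) by simp
next
  case (Suc m)
  then obtain r where r: "(pderiv ^^ m) p = u ^ (n - m) * r"
    by (auto elim: dvdE)
  have "n - m = Suc (n - Suc m)"
    using Suc.prems by simp
  then have "pderiv ((pderiv ^^ m) p) = pderiv (u ^ Suc (n - Suc m) * r)"
    unfolding r by simp
  also have "\<dots> = u ^ (n - Suc m) * (u * pderiv r + smult (real (Suc (n - Suc m))) (pderiv u) * r)"
    unfolding pderiv_mult pderiv_power_Suc by (simp add: algebra_simps del: of_nat_Suc)
  finally have "pderiv ((pderiv ^^ m) p) =
      u ^ (n - Suc m) * (u * pderiv r + smult (real (Suc (n - Suc m))) (pderiv u) * r)" .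
  then show ?case
    by simp
qed

lemma higher_pderiv_eq_0:
  fixes q :: "real poly"
  assumes "degree q < m"
  shows "(pderiv ^^ m) q = 0"
  using assms
proof (induction m arbitrary: q)
  case (Suc m)
  show ?case
  proof (cases "degree q = 0")
    case True
    then have "pderiv q = 0"
      by (simp add: pderiv_eq_0_iff)
    then show ?thesis
      by (simp only: funpow_Suc_right o_apply) (induction m, simp_all)
  next
    case False
    then have "(pderiv ^^ m) (pderiv q) = 0"
      using Suc by (simp add: degree_pderiv)
    then show ?thesis
      by (simp only: funpow_Suc_right o_apply)
  qed
qed simp

text \<open>Integration by parts \<open>m\<close> times moves all derivatives onto \<open>q\<close>. The boundary terms vanish since
  the derivatives of \<open>(x\<^sup>2 - x)\<^sup>s\<close> of order below \<open>s\<close> still contain the factor \<open>x\<^sup>2 - x\<close>.\<close>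

lemma rodrigues_orthogonal:
  fixes q :: "real poly"
  assumes "m \<le> s" and "(pderiv ^^ m) q = 0"
  shows "poly_integral 1 ((pderiv ^^ m) ([:0, -1, 1:] ^ s) * q) = 0"
  using assms
proof (induction m arbitrary: q)
  case 0
  then show ?case by (simp add: poly_integral_def)
next
  case (Suc m)
  let ?u = "[:0, -1, 1:] :: real poly"
  let ?W = "(pderiv ^^ m) (?u ^ s)"
  have "?u ^ (s - m) dvd ?W"
    using Suc.prems by (intro power_dvd_higher_pderiv) auto
  moreover have "?u dvd ?u ^ (s - m)"
    using Suc.prems by (intro dvd_power) auto
  ultimately have "?u dvd ?W"
    using dvd_trans by blast
  then have W0: "poly ?W 0 = 0" and W1: "poly ?W 1 = 0"
    by (auto elim!: dvdE)
  have parts: "pderiv ?W * q = pderiv (?W * q) + smult (- 1) (?W * pderiv q)"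
    by (simp add: pderiv_mult algebra_simps)
  have "poly_integral 1 (?W * pderiv q) = 0"
    using Suc.prems by (intro Suc.IH) (simp_all add: funpow_swap1)
  then have "poly_integral 1 (pderiv ?W * q) = 0"
    unfolding parts poly_integral_add poly_integral_smult poly_integral_pderiv by (simp add: W0 W1)
  then show ?case
    by simp
qed

lemma degree_shifted_legendre: "degree (shifted_legendre s) = s"
proof -
  have "degree ((pderiv ^^ m) p) = degree p - m" for m and p :: "real poly"
    by (induction m) (simp_all add: degree_pderiv)
  then show ?thesis
    by (simp add: shifted_legendre_def degree_power_eq)
qed

lemma shifted_legendre_orthogonal:
  fixes q :: "real poly"
  assumes "degree q < s"
  shows "poly_integral 1 (shifted_legendre s * q) = 0"
  using rodrigues_orthogonal[OF order_refl higher_pderiv_eq_0[OF assms]]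
  unfolding shifted_legendre_def mult_smult_left poly_integral_smult by simp

section \<open>Gauss quadrature and symplecticity\<close>

definition lagrange_poly :: "nat \<Rightarrow> (nat \<Rightarrow> real) \<Rightarrow> nat \<Rightarrow> real poly" where
  "lagrange_poly s c j = (\<Prod>m\<in>{1..s} - {j}. smult (1 / (c j - c m)) [:- c m, 1:])"

lemma poly_lagrange_poly: "poly (lagrange_poly s c j) x = lagrange_basis s c j x"
  by (simp add: lagrange_poly_def lagrange_basis_def poly_prod diff_divide_distrib)

lemma degree_lagrange_poly:
  assumes "j \<in> {1..s}"
  shows "degree (lagrange_poly s c j) < s"
proof -
  have "degree (lagrange_poly s c j)
      \<le> (\<Sum>m\<in>{1..s} - {j}. degree (smult (1 / (c j - c m)) [:- c m, 1:]))"
    unfolding lagrange_poly_def using degree_prod_sum_le[of "{1..s} - {j}"]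
    unfolding o_def by blast
  also have "\<dots> \<le> (\<Sum>m\<in>{1..s} - {j}. 1)"
    by (intro sum_mono) simp
  also have "\<dots> < s"
    using assms by simp
  finally show ?thesis .
qed

lemma lagrange_basis_node:
  assumes "inj_on c {1..s}" and "i \<in> {1..s}" and "j \<in> {1..s}"
  shows "lagrange_basis s c j (c i) = (if i = j then 1 else 0)"
proof (cases "i = j")
  case True
  have "c j \<noteq> c m" if "m \<in> {1..s} - {j}" for m
    using that assms by (auto dest: inj_onD)
  then show ?thesis
    using True by (simp add: lagrange_basis_def)
next
  case False
  then show ?thesis
    using assms by (auto simp: lagrange_basis_def intro!: prod_zero)
qed

lemma lagrange_interpolation:
  fixes r :: "real poly"
  assumes inj: "inj_on c {1..s}" and deg: "degree r < s"
  shows "r = (\<Sum>i=1..s. smult (poly r (c i)) (lagrange_poly s c i))"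
proof (rule poly_eqI_degree)
  have card: "card (c ` {1..s}) = s"
    using inj by (simp add: card_image)
  show "degree r < card (c ` {1..s})"
    using deg card by simp
  have "degree (\<Sum>i=1..s. smult (poly r (c i)) (lagrange_poly s c i)) < s"
    using deg
    by (intro degree_sum_less) (auto intro!: le_less_trans[OF degree_smult_le] degree_lagrange_poly)
  then show "degree (\<Sum>i=1..s. smult (poly r (c i)) (lagrange_poly s c i)) < card (c ` {1..s})"
    using card by simp
  fix x assume "x \<in> c ` {1..s}"
  then obtain k where k: "k \<in> {1..s}" "x = c k"
    by auto
  have "poly (\<Sum>i=1..s. smult (poly r (c i)) (lagrange_poly s c i)) (c k)
      = (\<Sum>i=1..s. poly r (c i) * (if k = i then 1 else 0))"
    unfolding poly_sum
    using inj k(1) by (intro sum.cong refl) (simp add: poly_lagrange_poly lagrange_basis_node)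
  also have "\<dots> = (\<Sum>i=1..s. if k = i then poly r (c i) else 0)"
    by (intro sum.cong) auto
  finally show "poly r x = poly (\<Sum>i=1..s. smult (poly r (c i)) (lagrange_poly s c i)) x"
    using k by simp
qed

text \<open>Dividing \<open>F\<close> by the Legendre polynomial leaves a quotient of degree below \<open>s\<close>, which
  contributes nothing to the integral by orthogonality, and nothing to the quadrature sum because the
  nodes are the zeros of the divisor. The remainder is its own interpolant, for which the rule is
  exact by the choice of the weights.\<close>

lemma gauss_quadrature_exact:
  fixes F :: "real poly"
  assumes gauss: "gauss_coefficients s a b c" and s: "s \<ge> 1" and deg: "degree F < 2 * s"
  shows "poly_integral 1 F = (\<Sum>i=1..s. b i * poly F (c i))"
proof -
  define L where "L = shifted_legendre s"
  define q where "q = F div L"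
  define r where "r = F mod L"
  have inj: "inj_on c {1..s}" and roots: "\<And>i. i \<in> {1..s} \<Longrightarrow> poly L (c i) = 0"
    and b: "\<And>i. i \<in> {1..s} \<Longrightarrow> b i = (LBINT x=0..1. lagrange_basis s c i x)"
    using gauss by (auto simp: gauss_coefficients_def bij_betw_def L_def)
  have degL: "degree L = s"
    by (simp add: L_def degree_shifted_legendre)
  then have "L \<noteq> 0"
    using s by auto
  have F: "F = L * q + r"
    by (simp add: q_def r_def)
  have degr: "degree r < s"
    using degree_mod_less[OF \<open>L \<noteq> 0\<close>, of F] s degL by (auto simp: r_def)
  have degq: "degree q < s"
  proof (cases "q = 0")
    case False
    have "degree (L * q) = degree (F - r)"
      using F by simp
    also have "\<dots> < 2 * s"
      using deg degr by (intro degree_diff_less) auto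
    finally show ?thesis
      using False \<open>L \<noteq> 0\<close> degL by (simp add: degree_mult_eq)
  qed (use s in simp)
  have "poly_integral 1 F = poly_integral 1 r"
    unfolding F poly_integral_add
    using shifted_legendre_orthogonal[OF degq] by (simp add: L_def)
  also have "\<dots> = poly_integral 1 (\<Sum>i=1..s. smult (poly r (c i)) (lagrange_poly s c i))"
    using lagrange_interpolation[OF inj degr] by simp
  also have "\<dots> = (\<Sum>i=1..s. poly r (c i) * poly_integral 1 (lagrange_poly s c i))"
    unfolding poly_integral_sum poly_integral_smult by simp
  also have "\<dots> = (\<Sum>i=1..s. b i * poly F (c i))"
    by (intro sum.cong refl) (simp add: b roots F poly_integral_def poly_lagrange_poly one_ereal_def)
  finally show ?thesis .
qed

text \<open>Exactness applied to the derivative of a product of two antiderivatives of Lagrange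
  polynomials. At the nodes, one factor of each summand is a Kronecker delta and the other is a
  coefficient \<open>a\<^sub>k\<^sub>l\<close>.\<close>

lemma gauss_symplectic:
  assumes gauss: "gauss_coefficients s a b c" and s: "s \<ge> 1"
    and i: "i \<in> {1..s}" and j: "j \<in> {1..s}"
  shows "b i * a i j + b j * a j i = b i * b j"
proof -
  have inj: "inj_on c {1..s}"
    using gauss by (simp add: gauss_coefficients_def bij_betw_def)
  define G where "G k = (SOME G. pderiv G = lagrange_poly s c k \<and> poly G 0 = 0 \<and>
      degree G \<le> degree (lagrange_poly s c k) + 1)" for k
  have G: "pderiv (G k) = lagrange_poly s c k" "poly (G k) 0 = 0"
      "degree (G k) \<le> degree (lagrange_poly s c k) + 1" for k
    using someI_ex[OF antiderivative_exists[of "lagrange_poly s c k"]] by (simp_all add: G_def)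
  have int: "(LBINT x=0..ereal t. lagrange_basis s c k x) = poly (G k) t" for k t
    using poly_integral_pderiv[of t "G k"] by (simp add: G poly_integral_def poly_lagrange_poly)
  have b: "b k = poly (G k) 1" if "k \<in> {1..s}" for k
    using gauss that int[of 1 k] by (simp add: gauss_coefficients_def one_ereal_def)
  have a: "a k l = poly (G l) (c k)" if "k \<in> {1..s}" "l \<in> {1..s}" for k l
    using gauss that int[of "c k" l] by (simp add: gauss_coefficients_def)
  have degG: "degree (G k) \<le> s" if "k \<in> {1..s}" for k
    using G(3)[of k] degree_lagrange_poly[OF that, of c] by simp
  have "degree (G i * G j) \<le> 2 * s"
    using degree_mult_le[of "G i" "G j"] degG[OF i] degG[OF j] by simp
  then have deg: "degree (pderiv (G i * G j)) < 2 * s"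
    using s by (simp add: degree_pderiv)
  have "b i * b j = poly_integral 1 (pderiv (G i * G j))"
    unfolding poly_integral_pderiv using i j by (simp add: G b)
  also have "\<dots> = (\<Sum>k=1..s. b k * poly (pderiv (G i * G j)) (c k))"
    by (rule gauss_quadrature_exact[OF gauss s deg])
  also have "\<dots> = (\<Sum>k=1..s. (if k = j then b k * a k i else 0) + (if k = i then b k * a k j else 0))"
    using i j
    by (intro sum.cong refl)
      (auto simp: pderiv_mult G poly_lagrange_poly lagrange_basis_node[OF inj] a algebra_simps)
  also have "\<dots> = b j * a j i + b i * a i j"
    using i j by (simp add: sum.distrib)
  finally show ?thesis
    by simp
qed

section \<open>The function space and its inner product\<close>

lemma C_k_zero: "C_k k (\<lambda>x. 0)"
  by (induction k) simp_all

lemma C_k_add: "C_k k f \<Longrightarrow> C_k k g \<Longrightarrow> C_k k (\<lambda>x. f x + g x)"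
proof (induction k arbitrary: f g)
  case (Suc k)
  have "frechet_derivative (\<lambda>x. f x + g x) (at x) =
      (\<lambda>v. frechet_derivative f (at x) v + frechet_derivative g (at x) v)" for x
    using Suc.prems
    by (intro frechet_derivative_at[symmetric] has_derivative_add)
      (simp_all flip: frechet_derivative_works)
  then show ?case
    using Suc by simp
qed (simp add: continuous_on_add)

lemma C_k_scaleR: "C_k k f \<Longrightarrow> C_k k (\<lambda>x. \<alpha> *\<^sub>R f x)"
proof (induction k arbitrary: f)
  case (Suc k)
  have "frechet_derivative (\<lambda>x. \<alpha> *\<^sub>R f x) (at x) =
      (\<lambda>v. \<alpha> *\<^sub>R frechet_derivative f (at x) v)" for x
    using Suc.prems
    by (intro frechet_derivative_at[symmetric] has_derivative_scaleR_right)
      (simp_all flip: frechet_derivative_works)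
  then show ?case
    using Suc by simp
qed (simp add: continuous_on_scaleR)

lemma space_V_zero: "(\<lambda>x. 0) \<in> space_V P"
  by (simp add: space_V_def periodic_space_def C_k_zero)

lemma space_V_add: "f \<in> space_V P \<Longrightarrow> g \<in> space_V P \<Longrightarrow> (\<lambda>x. f x + g x) \<in> space_V P"
  by (simp add: space_V_def periodic_space_def C_k_add)

lemma space_V_scaleR: "f \<in> space_V P \<Longrightarrow> (\<lambda>x. \<alpha> *\<^sub>R f x) \<in> space_V P"
  by (simp add: space_V_def periodic_space_def C_k_scaleR)

lemma space_V_sum:
  assumes "\<And>j. j \<in> A \<Longrightarrow> g j \<in> space_V P"
  shows "(\<lambda>x. \<Sum>j\<in>A. w j *\<^sub>R g j x) \<in> space_V P"
  using assms
  by (induction A rule: infinite_finite_induct) (simp_all add: space_V_zero space_V_add space_V_scaleR)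

text \<open>Stages and updates of a Runge--Kutta method all have the shape \<open>f + \<alpha> \<Sum> w\<^sub>j g\<^sub>j\<close>, so
  closure and linearity are recorded for this combination.\<close>

lemma space_V_increment:
  assumes "f \<in> space_V P" and "\<And>j. j \<in> A \<Longrightarrow> g j \<in> space_V P"
  shows "(\<lambda>x. f x + \<alpha> *\<^sub>R (\<Sum>j\<in>A. w j *\<^sub>R g j x)) \<in> space_V P"
  using assms by (intro space_V_add space_V_scaleR space_V_sum)

lemma linear_operator_on_sum:
  assumes T: "linear_operator_on (space_V P) T" and "\<And>j. j \<in> A \<Longrightarrow> g j \<in> space_V P"
  shows "T (\<lambda>x. \<Sum>j\<in>A. w j *\<^sub>R g j x) = (\<lambda>x. \<Sum>j\<in>A. w j *\<^sub>R T (g j) x)"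
proof -
  have "T (\<lambda>x. \<alpha> *\<^sub>R f x) = (\<lambda>x. \<alpha> *\<^sub>R T f x)" if "f \<in> space_V P" for \<alpha> f
    using T that unfolding linear_operator_on_def by blast
  from this[OF space_V_zero, of 0] have T0: "T (\<lambda>x. 0) = (\<lambda>x. 0)"
    by simp
  show ?thesis
    using assms(2)
  proof (induction A rule: infinite_finite_induct)
    case (insert k A)
    then have "(\<lambda>x. w k *\<^sub>R g k x) \<in> space_V P" "(\<lambda>x. \<Sum>j\<in>A. w j *\<^sub>R g j x) \<in> space_V P"
      by (simp_all add: space_V_scaleR space_V_sum)
    then show ?case
      using insert T by (simp add: linear_operator_on_def)
  qed (simp_all add: T0)
qed

lemma linear_operator_on_increment:
  assumes T: "linear_operator_on (space_V P) T" and f: "f \<in> space_V P"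
    and g: "\<And>j. j \<in> A \<Longrightarrow> g j \<in> space_V P"
  shows "T (\<lambda>x. f x + \<alpha> *\<^sub>R (\<Sum>j\<in>A. w j *\<^sub>R g j x))
    = (\<lambda>x. T f x + \<alpha> *\<^sub>R (\<Sum>j\<in>A. w j *\<^sub>R T (g j) x))"
proof -
  have S: "(\<lambda>x. \<Sum>j\<in>A. w j *\<^sub>R g j x) \<in> space_V P"
    using g by (rule space_V_sum)
  have "T (\<lambda>x. \<Sum>j\<in>A. w j *\<^sub>R g j x) = (\<lambda>x. \<Sum>j\<in>A. w j *\<^sub>R T (g j) x)"
    using T g by (rule linear_operator_on_sum)
  then show ?thesis
    using T f S space_V_scaleR[OF S, of \<alpha>] by (simp add: linear_operator_on_def)
qed

lemma ip_commute: "ip P f g = ip P g f"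
  by (simp add: ip_def L2_inner_def inner_commute)

lemma ip_integrable:
  assumes "f \<in> space_V P" and "g \<in> space_V P"
  shows "set_integrable lborel (cbox (lower P) (upper P)) (\<lambda>x. f x \<bullet> g x)"
proof -
  have cont: "continuous_on UNIV h" if "h \<in> space_V P" for h
  proof -
    have "C_k 0 h"
      using that unfolding space_V_def periodic_space_def
      by (auto simp: zero_enat_def[symmetric] simp del: C_k.simps)
    then show ?thesis
      by simp
  qed
  have "continuous_on (cbox (lower P) (upper P)) (\<lambda>x. f x \<bullet> g x)"
    using assms by (intro continuous_on_inner) (auto intro: cont continuous_on_subset)
  then show ?thesis
    unfolding set_integrable_def by (intro borel_integrable_compact) auto
qed

lemma ip_add_right:
  assumes "h \<in> space_V P" and "f \<in> space_V P" and "g \<in> space_V P"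
  shows "ip P h (\<lambda>x. f x + g x) = ip P h f + ip P h g"
  using assms by (simp add: ip_def L2_inner_def inner_add_right ip_integrable)

lemma ip_scaleR_right: "ip P h (\<lambda>x. \<alpha> *\<^sub>R f x) = \<alpha> * ip P h f"
  by (simp add: ip_def L2_inner_def)

lemma ip_increment_right:
  assumes h: "h \<in> space_V P" and f: "f \<in> space_V P" and g: "\<And>j. j \<in> A \<Longrightarrow> g j \<in> space_V P"
  shows "ip P h (\<lambda>x. f x + \<alpha> *\<^sub>R (\<Sum>j\<in>A. w j *\<^sub>R g j x))
    = ip P h f + \<alpha> * (\<Sum>j\<in>A. w j * ip P h (g j))"
proof -
  have "ip P h (\<lambda>x. \<Sum>j\<in>A. w j *\<^sub>R g j x) = (\<Sum>j\<in>A. w j * ip P h (g j))"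
    using g
  proof (induction A rule: infinite_finite_induct)
    case (insert k A)
    then show ?case
      using h by (simp add: ip_add_right ip_scaleR_right space_V_sum space_V_scaleR)
  qed (simp_all add: ip_def L2_inner_def)
  then show ?thesis
    using h f g by (simp add: ip_add_right ip_scaleR_right space_V_sum space_V_scaleR)
qed

lemma ip_increment_left:
  assumes "h \<in> space_V P" and "f \<in> space_V P" and "\<And>j. j \<in> A \<Longrightarrow> g j \<in> space_V P"
  shows "ip P (\<lambda>x. f x + \<alpha> *\<^sub>R (\<Sum>j\<in>A. w j *\<^sub>R g j x)) h
    = ip P f h + \<alpha> * (\<Sum>j\<in>A. w j * ip P (g j) h)"
  using ip_increment_right[OF assms] by (simp only: ip_commute[of P h])

lemma B_in_space_V:
  assumes "hamiltonian_pde P" and "z \<in> space_V P"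
  shows "B P z e \<in> space_V P"
proof -
  have "is_variational_derivative P (H2 P) (var_deriv P)"
    using assms(1) by (simp only: hamiltonian_pde_def)
  then have "var_deriv P z \<in> space_V P"
    using assms(2) by (simp add: is_variational_derivative_def)
  then show ?thesis
    unfolding B_def by (rule space_V_scaleR)
qed

section \<open>Linearity of the iteration step\<close>

lemma linear_operator_on_coefficient_op:
  assumes D: "linear_operator_on (space_V P) (skew_op P)"
    and L: "linear_operator_on (space_V P) (sym_op P)"
  shows "linear_operator_on (space_V P) (coefficient_op P a \<tau> i j)"
  unfolding linear_operator_on_def
proof (intro conjI ballI allI)
  fix f assume f: "f \<in> space_V P"
  then have DL: "skew_op P (sym_op P f) \<in> space_V P"
    using D L by (simp add: linear_operator_on_def)
  have "(\<lambda>x. if i = j then f x else 0) \<in> space_V P"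
    using f by (cases "i = j") (simp_all add: space_V_zero)
  from space_V_add[OF this space_V_scaleR[OF DL, of "- (\<tau> * a i j)"]]
  show "coefficient_op P a \<tau> i j f \<in> space_V P"
    by (simp add: coefficient_op_def)
  fix \<alpha>
  show "coefficient_op P a \<tau> i j (\<lambda>x. \<alpha> *\<^sub>R f x) = (\<lambda>x. \<alpha> *\<^sub>R coefficient_op P a \<tau> i j f x)"
    using f D L by (auto simp: coefficient_op_def linear_operator_on_def algebra_simps)
next
  fix f g assume "f \<in> space_V P" "g \<in> space_V P"
  then show "coefficient_op P a \<tau> i j (\<lambda>x. f x + g x)
      = (\<lambda>x. coefficient_op P a \<tau> i j f x + coefficient_op P a \<tau> i j g x)"
    using D L by (auto simp: coefficient_op_def linear_operator_on_def algebra_simps)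
qed

text \<open>Additivity of \<open>D\<close> splits each \<open>k\<^sub>j\<close> into \<open>D L y\<^sub>j\<close>, which moves to the left of the stage
  equation, and \<open>D B\<^sub>j\<close>, which stays as data. That is why the previous iterates must lie in the
  function space: otherwise \<open>D\<close> need not be additive on the sum.\<close>

lemma eliminated_system_iff:
  assumes P: "hamiltonian_pde P" and Z: "\<And>j. j \<in> {1..s} \<Longrightarrow> Z j \<in> space_V P"
    and y: "\<And>j. j \<in> {1..s} \<Longrightarrow> y j \<in> space_V P" and i: "i \<in> {1..s}"
  shows "(\<lambda>x. \<Sum>j=1..s. coefficient_op P a \<tau> i j (y j) x) = right_hand_side P s a \<tau> zn Z E i \<longleftrightarrow>
    y i = (\<lambda>x. zn x + \<tau> *\<^sub>R (\<Sum>j=1..s. a i j *\<^sub>R explicit_k P Z E y j x))"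
proof -
  have D: "linear_operator_on (space_V P) (skew_op P)"
    and L: "linear_operator_on (space_V P) (sym_op P)"
    using P by (auto simp: hamiltonian_pde_def)
  let ?DL = "\<lambda>j. skew_op P (sym_op P (y j))" and ?DB = "\<lambda>j. skew_op P (B P (Z j) (E j))"
  have k: "explicit_k P Z E y j = (\<lambda>x. ?DL j x + ?DB j x)" if "j \<in> {1..s}" for j
    using D L y[OF that] B_in_space_V[OF P Z[OF that], of "E j"]
    by (simp add: explicit_k_def explicit_mu_def linear_operator_on_def)
  have rk: "(\<Sum>j=1..s. a i j *\<^sub>R explicit_k P Z E y j x)
      = (\<Sum>j=1..s. a i j *\<^sub>R ?DL j x) + (\<Sum>j=1..s. a i j *\<^sub>R ?DB j x)" for x
    unfolding sum.distrib[symmetric] by (intro sum.cong refl) (simp add: k scaleR_add_right)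
  have lhs: "(\<Sum>j=1..s. coefficient_op P a \<tau> i j (y j) x)
      = y i x - \<tau> *\<^sub>R (\<Sum>j=1..s. a i j *\<^sub>R ?DL j x)" for x
    using i by (simp add: coefficient_op_def sum_subtractf scaleR_sum_right)
  show ?thesis
    unfolding fun_eq_iff rk lhs right_hand_side_def by (simp add: algebra_simps)
qed

lemma iteration_is_linear:
  assumes P: "hamiltonian_pde P"
  shows "linear_iteration P s a \<tau>"
  unfolding linear_iteration_def
proof (intro conjI ballI allI impI)
  show "linear_operator_on (space_V P) (coefficient_op P a \<tau> i j)" for i j
    using P by (intro linear_operator_on_coefficient_op) (auto simp: hamiltonian_pde_def)
next
  fix zn :: "'a \<Rightarrow> 'b" and en :: real and Z E and Y :: "('a, 'b) stages"
  assume Z: "\<forall>i\<in>{1..s}. Z i \<in> space_V P"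
  let ?explicit = "\<forall>i\<in>{1..s}.
      stg_mu Y i = explicit_mu P Z E (stg_z Y) i \<and> stg_k Y i = explicit_k P Z E (stg_z Y) i \<and>
      stg_l Y i = explicit_l P Z E (stg_z Y) i \<and> stg_e Y i = explicit_e P s a \<tau> en Z E (stg_z Y) i"
  have "iteration_step P s a \<tau> zn en Z E Y \<longleftrightarrow>
      (\<forall>i\<in>{1..s}. stg_z Y i \<in> space_V P \<and>
        stg_z Y i = (\<lambda>x. zn x + \<tau> *\<^sub>R (\<Sum>j=1..s. a i j *\<^sub>R explicit_k P Z E (stg_z Y) j x))) \<and>
      ?explicit" (is "?step \<longleftrightarrow> ?rk \<and> _")
  proof
    assume step: ?step
    then have mu: "stg_mu Y i = explicit_mu P Z E (stg_z Y) i" if "i \<in> {1..s}" for i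
      using that by (simp add: iteration_step_def explicit_mu_def)
    with step have k: "stg_k Y i = explicit_k P Z E (stg_z Y) i" if "i \<in> {1..s}" for i
      using that by (simp add: iteration_step_def explicit_k_def)
    with step have l: "stg_l Y i = explicit_l P Z E (stg_z Y) i" if "i \<in> {1..s}" for i
      using that by (simp add: iteration_step_def explicit_l_def)
    have "stg_z Y i = (\<lambda>x. zn x + \<tau> *\<^sub>R (\<Sum>j=1..s. a i j *\<^sub>R stg_k Y j x))"
        "stg_e Y i = exp (ln en + \<tau> * (\<Sum>j=1..s. a i j * stg_l Y j))"
        "stg_z Y i \<in> space_V P" if "i \<in> {1..s}" for i
      using step that unfolding iteration_step_def by blast+
    moreover have "(\<Sum>j=1..s. a i j *\<^sub>R stg_k Y j x)
          = (\<Sum>j=1..s. a i j *\<^sub>R explicit_k P Z E (stg_z Y) j x)" for i x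
      by (intro sum.cong refl) (simp add: k)
    moreover have "(\<Sum>j=1..s. a i j * stg_l Y j)
          = (\<Sum>j=1..s. a i j * explicit_l P Z E (stg_z Y) j)" for i
      by (intro sum.cong refl) (simp add: l)
    ultimately show "?rk \<and> ?explicit"
      unfolding explicit_e_def by (intro conjI ballI) (simp_all only: mu k l)
  next
    assume rhs: "?rk \<and> ?explicit"
    then have k: "stg_k Y i = explicit_k P Z E (stg_z Y) i"
        and l: "stg_l Y i = explicit_l P Z E (stg_z Y) i" if "i \<in> {1..s}" for i
      using that by blast+
    show ?step
      unfolding iteration_step_def
    proof (intro ballI conjI)
      fix i assume i: "i \<in> {1..s}"
      show "stg_z Y i \<in> space_V P"
        using rhs i by blast
      have "(\<Sum>j=1..s. a i j *\<^sub>R stg_k Y j x)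
          = (\<Sum>j=1..s. a i j *\<^sub>R explicit_k P Z E (stg_z Y) j x)" for x
        by (intro sum.cong refl) (simp add: k)
      moreover have "stg_z Y i = (\<lambda>x. zn x + \<tau> *\<^sub>R (\<Sum>j=1..s. a i j *\<^sub>R explicit_k P Z E (stg_z Y) j x))"
        using rhs i by blast
      ultimately show "stg_z Y i = (\<lambda>x. zn x + \<tau> *\<^sub>R (\<Sum>j=1..s. a i j *\<^sub>R stg_k Y j x))"
        by (simp only:)
      show "stg_k Y i = skew_op P (stg_mu Y i)"
        using rhs i by (simp add: explicit_k_def)
      show "stg_mu Y i = (\<lambda>x. sym_op P (stg_z Y i) x + B P (Z i) (E i) x)"
        using rhs i by (simp add: explicit_mu_def)
      show "stg_e Y i = exp (ln en + \<tau> * (\<Sum>j=1..s. a i j * stg_l Y j))"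
        using rhs i by (simp only: explicit_e_def l cong: sum.cong)
      show "stg_l Y i = ip P (B P (Z i) (E i)) (stg_k Y i)"
        using rhs i by (simp add: explicit_l_def)
    qed
  qed
  also have "?rk \<longleftrightarrow> (\<forall>i\<in>{1..s}. stg_z Y i \<in> space_V P \<and>
      (\<lambda>x. \<Sum>j=1..s. coefficient_op P a \<tau> i j (stg_z Y j) x) = right_hand_side P s a \<tau> zn Z E i)"
    using eliminated_system_iff[OF P, of s Z "stg_z Y" _ a \<tau> zn E] Z by blast
  finally show "iteration_step P s a \<tau> zn en Z E Y \<longleftrightarrow>
      (\<forall>i\<in>{1..s}. stg_z Y i \<in> space_V P \<and>
        (\<lambda>x. \<Sum>j=1..s. coefficient_op P a \<tau> i j (stg_z Y j) x) = right_hand_side P s a \<tau> zn Z E i) \<and>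
      ?explicit" .
qed

section \<open>Energy conservation\<close>

text \<open>The product rule for the quadratic form of a symmetric operator. Expanding both sides around
  \<open>z\<close> leaves the double sums over \<open>b\<^sub>i b\<^sub>j K\<^sub>i\<^sub>j\<close> and over \<open>2 b\<^sub>i a\<^sub>i\<^sub>j K\<^sub>i\<^sub>j\<close>, where
  \<open>K\<^sub>i\<^sub>j = (k\<^sub>i, L k\<^sub>j)\<close> is symmetric; symmetrising the second turns it into the first by
  symplecticity.\<close>

lemma quadratic_energy_increment:
  fixes k zs :: "nat \<Rightarrow> 'd::euclidean_space \<Rightarrow> 'v::euclidean_space"
  assumes L: "linear_operator_on (space_V P) (sym_op P)"
    and sym: "\<And>f g. f \<in> space_V P \<Longrightarrow> g \<in> space_V P \<Longrightarrow> ip P (sym_op P f) g = ip P f (sym_op P g)"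
    and symplectic: "\<And>i j. i \<in> {1..s} \<Longrightarrow> j \<in> {1..s} \<Longrightarrow> b i * a i j + b j * a j i = b i * b j"
    and z: "z \<in> space_V P" and k: "\<And>i. i \<in> {1..s} \<Longrightarrow> k i \<in> space_V P"
    and zs: "\<And>i. i \<in> {1..s} \<Longrightarrow> zs i = (\<lambda>x. z x + \<tau> *\<^sub>R (\<Sum>j=1..s. a i j *\<^sub>R k j x))"
    and z1: "z1 = (\<lambda>x. z x + \<tau> *\<^sub>R (\<Sum>i=1..s. b i *\<^sub>R k i x))"
  shows "1/2 * ip P z1 (sym_op P z1) - 1/2 * ip P z (sym_op P z)
    = \<tau> * (\<Sum>i=1..s. b i * ip P (k i) (sym_op P (zs i)))"
proof -
  define K where "K i j = ip P (k i) (sym_op P (k j))" for i j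
  define p where "p i = ip P (k i) (sym_op P z)" for i
  have LV: "sym_op P f \<in> space_V P" if "f \<in> space_V P" for f
    using L that by (simp add: linear_operator_on_def)
  have swap: "ip P f (sym_op P g) = ip P g (sym_op P f)"
    if "f \<in> space_V P" "g \<in> space_V P" for f g
    using sym[OF that] by (simp add: ip_commute)
  have K_sym: "K i j = K j i" if "i \<in> {1..s}" "j \<in> {1..s}" for i j
    using that by (simp add: K_def swap k)
  have Lz1: "sym_op P z1 = (\<lambda>x. sym_op P z x + \<tau> *\<^sub>R (\<Sum>i=1..s. b i *\<^sub>R sym_op P (k i) x))"
    unfolding z1 using k by (intro linear_operator_on_increment[OF L z]) auto
  have z1_V: "z1 \<in> space_V P"
    unfolding z1 using z k by (intro space_V_increment)
  have z1_ip: "ip P z1 h = ip P z h + \<tau> * (\<Sum>i=1..s. b i * ip P (k i) h)" if "h \<in> space_V P" for h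
    unfolding z1 using that z k by (intro ip_increment_left)
  have "ip P z1 (sym_op P z1)
      = ip P z1 (sym_op P z) + \<tau> * (\<Sum>j=1..s. b j * ip P z1 (sym_op P (k j)))"
    unfolding Lz1 using z1_V z k LV by (intro ip_increment_right) auto
  also have "ip P z1 (sym_op P z) = ip P z (sym_op P z) + \<tau> * (\<Sum>i=1..s. b i * p i)"
    using z LV by (simp add: z1_ip p_def)
  also have "(\<Sum>j=1..s. b j * ip P z1 (sym_op P (k j)))
      = (\<Sum>j=1..s. b j * (p j + \<tau> * (\<Sum>i=1..s. b i * K i j)))"
    using z k LV by (intro sum.cong refl) (simp add: z1_ip p_def K_def swap[of z])
  also have "\<dots> = (\<Sum>j=1..s. b j * p j) + \<tau> * (\<Sum>j=1..s. \<Sum>i=1..s. b i * b j * K i j)"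
    by (simp add: algebra_simps sum.distrib sum_distrib_left)
  finally have energy: "ip P z1 (sym_op P z1) - ip P z (sym_op P z)
      = 2 * \<tau> * (\<Sum>i=1..s. b i * p i) + \<tau> * \<tau> * (\<Sum>j=1..s. \<Sum>i=1..s. b i * b j * K i j)"
    by (simp add: algebra_simps)
  have "(\<Sum>i=1..s. b i * ip P (k i) (sym_op P (zs i)))
      = (\<Sum>i=1..s. b i * (p i + \<tau> * (\<Sum>j=1..s. a i j * K i j)))"
  proof (intro sum.cong refl)
    fix i assume i: "i \<in> {1..s}"
    have "sym_op P (zs i) = (\<lambda>x. sym_op P z x + \<tau> *\<^sub>R (\<Sum>j=1..s. a i j *\<^sub>R sym_op P (k j) x))"
      unfolding zs[OF i] using k by (intro linear_operator_on_increment[OF L z]) auto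
    then have "ip P (k i) (sym_op P (zs i)) = p i + \<tau> * (\<Sum>j=1..s. a i j * K i j)"
      unfolding p_def K_def using z k LV i by (simp only:) (intro ip_increment_right, auto)
    then show "b i * ip P (k i) (sym_op P (zs i)) = b i * (p i + \<tau> * (\<Sum>j=1..s. a i j * K i j))"
      by simp
  qed
  also have "\<dots> = (\<Sum>i=1..s. b i * p i) + \<tau> * (\<Sum>i=1..s. \<Sum>j=1..s. b i * a i j * K i j)"
    by (simp add: algebra_simps sum.distrib sum_distrib_left)
  finally have stages: "(\<Sum>i=1..s. b i * ip P (k i) (sym_op P (zs i))) = \<dots>" .
  have "2 * (\<Sum>i=1..s. \<Sum>j=1..s. b i * a i j * K i j)
      = (\<Sum>i=1..s. \<Sum>j=1..s. b i * a i j * K i j) + (\<Sum>j=1..s. \<Sum>i=1..s. b i * a i j * K i j)"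
    by (subst (2) sum.swap) simp
  also have "\<dots> = (\<Sum>j=1..s. \<Sum>i=1..s. b j * a j i * K j i + b i * a i j * K i j)"
    by (simp add: sum.distrib)
  also have "\<dots> = (\<Sum>j=1..s. \<Sum>i=1..s. b i * b j * K i j)"
  proof (intro sum.cong refl)
    fix j i assume ij: "j \<in> {1..s}" "i \<in> {1..s}"
    have "b j * a j i * K j i + b i * a i j * K i j = (b i * a i j + b j * a j i) * K i j"
      using K_sym[OF ij] by (simp add: algebra_simps)
    then show "b j * a j i * K j i + b i * a i j * K i j = b i * b j * K i j"
      using symplectic ij by simp
  qed
  finally have "(\<Sum>j=1..s. \<Sum>i=1..s. b i * b j * K i j)
      = 2 * (\<Sum>i=1..s. \<Sum>j=1..s. b i * a i j * K i j)" ..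
  then show ?thesis
    using energy unfolding stages by (simp add: algebra_simps)
qed

text \<open>The common core of all iteration indices: conservation holds for every solution of a
  single iteration step, from whatever previous iterates in the function space it starts.\<close>

lemma iteration_step_conserves_energy:
  fixes P :: "('d::euclidean_space, 'v::euclidean_space) ham_pde"
  assumes P: "hamiltonian_pde P"
    and symplectic: "\<And>i j. i \<in> {1..s} \<Longrightarrow> j \<in> {1..s} \<Longrightarrow> b i * a i j + b j * a j i = b i * b j"
    and step: "iteration_step P s a \<tau> zn en Z E Y"
    and zn: "zn \<in> space_V P" and Z: "\<And>i. i \<in> {1..s} \<Longrightarrow> Z i \<in> space_V P"
    and zn1: "zn1 = (\<lambda>x. zn x + \<tau> *\<^sub>R (\<Sum>i=1..s. b i *\<^sub>R stg_k Y i x))"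
    and en1: "en1 = exp (ln en + \<tau> * (\<Sum>i=1..s. b i * stg_l Y i))"
  shows "zn1 \<in> space_V P" and "modified_energy P zn1 en1 = modified_energy P zn en"
proof -
  let ?k = "stg_k Y" and ?z = "stg_z Y" and ?mu = "stg_mu Y"
  have D: "linear_operator_on (space_V P) (skew_op P)"
    and L: "linear_operator_on (space_V P) (sym_op P)"
    and skew: "\<And>f g. f \<in> space_V P \<Longrightarrow> g \<in> space_V P \<Longrightarrow> ip P (skew_op P f) g = - ip P f (skew_op P g)"
    and sym: "\<And>f g. f \<in> space_V P \<Longrightarrow> g \<in> space_V P \<Longrightarrow> ip P (sym_op P f) g = ip P f (sym_op P g)"
    using P by (auto simp: hamiltonian_pde_def)
  have zV: "?z i \<in> space_V P"
    and z_eq: "?z i = (\<lambda>x. zn x + \<tau> *\<^sub>R (\<Sum>j=1..s. a i j *\<^sub>R ?k j x))"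
    and k_eq: "?k i = skew_op P (?mu i)"
    and mu_eq: "?mu i = (\<lambda>x. sym_op P (?z i) x + B P (Z i) (E i) x)"
    and l_eq: "stg_l Y i = ip P (B P (Z i) (E i)) (?k i)" if "i \<in> {1..s}" for i
    using step that unfolding iteration_step_def by blast+
  have BV: "B P (Z i) (E i) \<in> space_V P" if "i \<in> {1..s}" for i
    using B_in_space_V[OF P Z[OF that]] .
  have LzV: "sym_op P (?z i) \<in> space_V P" if "i \<in> {1..s}" for i
    using L zV[OF that] by (simp add: linear_operator_on_def)
  have muV: "?mu i \<in> space_V P" if "i \<in> {1..s}" for i
    unfolding mu_eq[OF that] using BV LzV that by (intro space_V_add)
  have kV: "?k i \<in> space_V P" if "i \<in> {1..s}" for i
    using D muV[OF that] k_eq[OF that] by (simp add: linear_operator_on_def)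
  show "zn1 \<in> space_V P"
    unfolding zn1 using zn kV by (intro space_V_increment)
  have no_production: "ip P (?k i) (sym_op P (?z i)) + stg_l Y i = 0" if i: "i \<in> {1..s}" for i
  proof -
    have "ip P (?k i) (sym_op P (?z i)) + stg_l Y i = ip P (?k i) (?mu i)"
      using kV[OF i] LzV[OF i] BV[OF i]
      by (simp add: mu_eq[OF i] l_eq[OF i] ip_add_right ip_commute[of P "B P (Z i) (E i)"])
    also have "\<dots> = 0"
      using skew[OF muV[OF i] muV[OF i]] k_eq[OF i] by (simp add: ip_commute)
    finally show ?thesis .
  qed
  have "1/2 * ip P zn1 (sym_op P zn1) - 1/2 * ip P zn (sym_op P zn)
      = \<tau> * (\<Sum>i=1..s. b i * ip P (?k i) (sym_op P (?z i)))"
    using quadratic_energy_increment[OF L sym symplectic zn kV z_eq zn1] .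
  moreover have "ln en1 - ln en = \<tau> * (\<Sum>i=1..s. b i * stg_l Y i)"
    by (simp add: en1)
  ultimately have "modified_energy P zn1 en1 - modified_energy P zn en
      = \<tau> * (\<Sum>i=1..s. b i * (ip P (?k i) (sym_op P (?z i)) + stg_l Y i))"
    by (simp add: modified_energy_def distrib_left sum.distrib)
  also have "\<dots> = 0"
    using no_production by simp
  finally show "modified_energy P zn1 en1 = modified_energy P zn en"
    by simp
qed

text \<open>Only the last iteration enters the update, and its input lies in the function space: it is the
  prediction if the iteration stops at once, and the solution of the preceding iteration step
  otherwise.\<close>

lemma time_step_conserves_energy:
  fixes P :: "('d::euclidean_space, 'v::euclidean_space) ham_pde"
  assumes P: "hamiltonian_pde P"
    and symplectic: "\<And>i j. i \<in> {1..s} \<Longrightarrow> j \<in> {1..s} \<Longrightarrow> b i * a i j + b j * a j i = b i * b j"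
    and step: "time_step P s a b \<tau> \<Lambda> zn en zs es lam Y zn1 en1"
    and zn: "zn \<in> space_V P" and zs: "\<forall>i\<in>{1..s}. zs i \<in> space_V P"
  shows "zn1 \<in> space_V P" and "modified_energy P zn1 en1 = modified_energy P zn en"
proof -
  have lam: "lam \<ge> 1" and predicted: "\<And>i. i \<in> {1..s} \<Longrightarrow> stg_z (Y 1) i = zs i"
    and iter: "\<And>\<nu>. \<nu> \<in> {1..lam} \<Longrightarrow>
      iteration_step P s a \<tau> zn en (stg_z (Y \<nu>)) (stg_e (Y \<nu>)) (Y (\<nu> + 1))"
    and upd: "zn1 = (\<lambda>x. zn x + \<tau> *\<^sub>R (\<Sum>i=1..s. b i *\<^sub>R stg_k (Y (lam + 1)) i x))"
      "en1 = exp (ln en + \<tau> * (\<Sum>i=1..s. b i * stg_l (Y (lam + 1)) i))"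
    using step by (auto simp: time_step_def)
  have last_input: "stg_z (Y lam) i \<in> space_V P" if i: "i \<in> {1..s}" for i
  proof (cases "lam = 1")
    case True
    then show ?thesis
      using predicted zs i by simp
  next
    case False
    then have "iteration_step P s a \<tau> zn en (stg_z (Y (lam - 1))) (stg_e (Y (lam - 1))) (Y lam)"
      using iter[of "lam - 1"] lam by simp
    then show ?thesis
      using i unfolding iteration_step_def by blast
  qed
  have "iteration_step P s a \<tau> zn en (stg_z (Y lam)) (stg_e (Y lam)) (Y (lam + 1))"
    using iter lam by simp
  from iteration_step_conserves_energy[OF P symplectic this zn last_input upd]
  show "zn1 \<in> space_V P" "modified_energy P zn1 en1 = modified_energy P zn en"
    by blast+
qed

theorem theorem3p3:
  fixes P :: "('d::euclidean_space, 'v::euclidean_space) ham_pde"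
    and s \<Lambda> :: nat
    and a :: "nat \<Rightarrow> nat \<Rightarrow> real" and b c :: "nat \<Rightarrow> real"
    and t0 \<tau> :: real
  assumes "hamiltonian_pde P"
    and "\<tau> > 0" and "s \<ge> 1" and "\<Lambda> \<ge> 1"
    and "gauss_coefficients s a b c"
  shows "linear_iteration P s a \<tau> \<and>
         (\<forall>M z e zs es lam Y.
            esav_gauss_pc P s a b c t0 \<tau> \<Lambda> M z e zs es lam Y \<longrightarrow>
            (\<forall>n<M. modified_energy P (z (Suc n)) (e (Suc n)) = modified_energy P (z n) (e n)))"
proof (intro conjI allI impI)
  show "linear_iteration P s a \<tau>"
    using assms(1) by (rule iteration_is_linear)
  fix M z e zs es lam Y n
  assume scheme: "esav_gauss_pc P s a b c t0 \<tau> \<Lambda> M z e zs es lam Y" and n: "n < M"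
  have step: "time_step P s a b \<tau> \<Lambda> (z n) (e n) (zs n) (es n) (lam n) (Y n) (z (Suc n)) (e (Suc n))"
    and zs: "\<forall>i\<in>{1..s}. zs n i \<in> space_V P" if "n < M" for n
    using scheme that by (auto simp: esav_gauss_pc_def)
  note conserves = time_step_conserves_energy[OF assms(1) gauss_symplectic[OF assms(5,3)] step _ zs]
  have "z m \<in> space_V P" if "m \<le> M" for m
    using that
  proof (induction m)
    case 0
    then show ?case
      using scheme by (simp add: esav_gauss_pc_def)
  next
    case (Suc m)
    then show ?case
      using conserves(1)[of m] by simp
  qed
  then show "modified_energy P (z (Suc n)) (e (Suc n)) = modified_energy P (z n) (e n)"
    using conserves(2)[of n] n by simp
qed

end
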